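(* Let $g\ge1$, $n\ge1$ with $2g-2+n\ge2$, and let $d,d_1,\dots,d_{n-1}\ge0$ be integers with $d+\sum_{i=1}^{n-1}d_i=g-1$; write $\mathbf d=\{d_1,\dots,d_{n-1}\}$. The top-degree terms (the coefficients of $b^{2d+1}\prod_{i=1}^{n-1}b_i^{2d_i}$ on the two sides) of the recursion (N) for super volumes (see context) recover the identity $$-(2d+1)!!\,\langle\tau_d,\tau_{\mathbf d}\rangle^\Theta_g=\frac12\sum_{\mu+\nu=d-1}(2\mu+1)!!(2\nu+1)!!\,\langle\tau_\mu,\tau_\nu,\tau_{\mathbf d}\rangle^\Theta_{g-1}+\frac12\sum_{\substack{g_1+g_2=g\\ \mathbf d_1\sqcup\mathbf d_2=\mathbf d}}(2\mu+1)!!(2\nu+1)!!\,\langle\tau_\mu,\tau_{\mathbf d_1}\rangle^\Theta_{g_1}\langle\tau_\nu,\tau_{\mathbf d_2}\rangle^\Theta_{g_2}+\sum_{j=1}^{n-1}\frac{(2d+2d_j+1)!!}{(2d_j-1)!!}\,\langle\tau_{d+d_j},\tau_{\mathbf d\setminus d_j}\rangle^\Theta_g,$$ where in the second sum $\mu,\nu\ge0$ are determined by $\mu+\sum_{d_i\in\mathbf d_1}d_i=g_1-1$ and $\nu+\sum_{d_i\in\mathbf d_2}d_i=g_2-1$.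
   Context: On the Deligne–Mumford space $\overline{\mathcal M}_{g,n}$, $\psi_i$ is the first Chern class of the $i$-th tautological (cotangent) line bundle and $\kappa_1$ the first Mumford tautological class. $\Theta_{g,n}\in H^{4g-4+2n}(\overline{\mathcal M}_{g,n};\mathbb Q)$ is the Norbury class: let $\overline{\mathcal M}^{\rm spin}_{g,n}$ be the moduli stack of stable twisted spin curves $(C,\theta,p_1,\dots,p_n,\phi)$, where $C$ is a twisted curve with $\mathbb Z/2$ isotropy at marked points and nodes, $\phi:\theta^2\cong\omega_C^{\log}$, and the isotropy acts nontrivially on $\theta$ at each $p_i$; with $\rho$ the universal curve, $\mathcal E$ the universal spin bundle and $p:\overline{\mathcal M}^{\rm spin}_{g,n}\to\overline{\mathcal M}_{g,n}$ the forgetful map, $E_{g,n}=-R\rho_*\mathcal E^\vee$ is a bundle of rank $2g-2+n$ and $\Theta_{g,n}=(-1)^n2^{g-1+n}p_*c_{2g-2+n}(E_{g,n})$. For $\sum_{i=1}^n d_i=g-1$, $\langle\tau_{d_1},\dots,\tau_{d_n}\rangle^\Theta_g=\int_{\overline{\mathcal M}_{g,n}}\Theta_{g,n}\prod_i\psi_i^{d_i}$; $\tau_{\mathbf d}$ abbreviates $\tau_{d_1},\dots,\tau_{d_{n-1}}$. The super volumes in Norbury's normalization are the even symmetric polynomials $\widehat V_{g,n}(\mathbf b)=\int_{\overline{\mathcal M}_{g,n}}\Theta_{g,n}\exp(2\pi^2\kappa_1+\frac12\sum b_i^2\psi_i)$ of degree $2g-2$ ($\widehat V_{0,n}=0$,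 $\widehat V_{1,1}=\frac18$); their coefficient at $\prod b_i^{2d_i}$ with $\sum d_i=g-1$ is $\langle\tau_{d_1},\dots,\tau_{d_n}\rangle^\Theta_g/\prod(2d_i)!!$. For $\mathbf b=(b_1,\dots,b_{n-1})$ and $2g-2+n\ge2$, the recursion (N) for them is $$-\frac12\Big((b+2\pi i)\widehat V_{g,n}(b+2\pi i,\mathbf b)+(b-2\pi i)\widehat V_{g,n}(b-2\pi i,\mathbf b)\Big)=\frac12\int_0^b b'(b-b')\widehat V_{g-1,n+1}(b',b-b',\mathbf b)\,db'+\frac12\sum_{\substack{g_1+g_2=g\\ \mathbf b_1\sqcup\mathbf b_2=\mathbf b}}\int_0^b b'(b-b')\widehat V_{g_1,n_1}(b',\mathbf b_1)\widehat V_{g_2,n_2}(b-b',\mathbf b_2)\,db'+\frac12\sum_{j=1}^{n-1}\Big((b+b_j)\widehat V_{g,n-1}(b+b_j,\mathbf b\setminus b_j)+(b-b_j)\widehat V_{g,n-1}(b-b_j,\mathbf b\setminus b_j)\Big).$$ Conventions: sums over $g_1+g_2=g$ and partitions are over ordered pairs of nonnegative integers and ordered set partitions (of the labelled entries), $n_i=|\mathbf b_i|+1=|\mathbf d_i|+1$; $\mathbf b\setminus b_j$ and $\mathbf d\setminus d_j$ mean the entry is removed; $\mu,\nu\ge0$; terms with $g'\le0$, $2g'-2+n'\le0$ or negative index are zero; $(-1)!!=0!!=1$. *)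

theory Defs
  imports "HOL-Complex_Analysis.Complex_Analysis"
begin

section \<open>Cohomological data\<close>

text \<open>
  The moduli spaces themselves are not constructed. A record of this type holds, for all pairs
  (g,n) at once, the part of their cohomology (even degree, complex coefficients) that enters the
  definition of the Norbury class, the intersection numbers and the super volumes.

  One type \<open>'h\<close> serves every (g,n): think of the product over all (g,n) of the rings
  \<open>H\<^sup>e\<^sup>v(\<M>\<^sub>g\<^sub>,\<^sub>n)\<close>, where \<open>Coh M g n k\<close> consists of the elements whose (g,n) component lies in
  \<open>H\<^sup>2\<^sup>k\<close>, and \<open>integ M g n\<close> integrates the (g,n) component. Likewise \<open>'s\<close> for the spin moduli
  spaces. Degrees are complex degrees. Marked points are numbered \<open>0, \<dots>, n - 1\<close>.
\<close>

record ('h, 's) moduli_data =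
  scl :: "complex \<Rightarrow> 'h \<Rightarrow> 'h"
  spin_scl :: "complex \<Rightarrow> 's \<Rightarrow> 's"
  Coh :: "nat \<Rightarrow> nat \<Rightarrow> nat \<Rightarrow> 'h set"
  SpinCoh :: "nat \<Rightarrow> nat \<Rightarrow> nat \<Rightarrow> 's set"
  integ :: "nat \<Rightarrow> nat \<Rightarrow> 'h \<Rightarrow> complex"
  psi :: "nat \<Rightarrow> nat \<Rightarrow> nat \<Rightarrow> 'h"
  kappa1 :: "nat \<Rightarrow> nat \<Rightarrow> 'h"
  spin_push :: "nat \<Rightarrow> nat \<Rightarrow> 's \<Rightarrow> 'h"   \<comment> \<open>\<open>p\<^sub>*\<close> for the forgetful map \<open>p\<close>\<close>
  chern_E :: "nat \<Rightarrow> nat \<Rightarrow> 's"   \<comment> \<open>the top Chern class \<open>c\<^bsub>2g-2+n\<^esub>(E\<^bsub>g,n\<^esub>)\<close>\<close>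

text \<open>\<open>2g - 2 + n > 0\<close>, without truncated subtraction\<close>
definition stable :: "nat \<Rightarrow> nat \<Rightarrow> bool" where
  "stable g n \<longleftrightarrow> 2 * g + n > 2"

definition Theta :: "('h::comm_ring_1, 's::ab_group_add) moduli_data \<Rightarrow> nat \<Rightarrow> nat \<Rightarrow> 'h" where
  "Theta M g n = scl M ((-1) ^ n * 2 ^ (g + n - 1)) (spin_push M g n (chern_E M g n))"

text \<open>
  The last clause is the invariance of integrals under relabelling of the marked points. The map
  \<open>p\<close> preserves complex dimension, so \<open>p\<^sub>*\<close> preserves degree.
\<close>
definition moduli_cohomology :: "('h::comm_ring_1, 's::ab_group_add) moduli_data \<Rightarrow> bool" where
  "moduli_cohomology M \<longleftrightarrow>
     vector_space (scl M) \<and> vector_space (spin_scl M) \<and>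
     (\<forall>c x y. scl M c x * y = scl M c (x * y)) \<and>
     (\<forall>g n. stable g n \<longrightarrow>
        (\<forall>k. module.subspace (scl M) (Coh M g n k)) \<and>
        (\<forall>k. module.subspace (spin_scl M) (SpinCoh M g n k)) \<and>
        1 \<in> Coh M g n 0 \<and>
        (\<forall>k l. \<forall>x\<in>Coh M g n k. \<forall>y\<in>Coh M g n l. x * y \<in> Coh M g n (k + l)) \<and>
        Vector_Spaces.linear (scl M) (*) (integ M g n) \<and>
        (\<forall>k. k \<noteq> 3 * g + n - 3 \<longrightarrow> (\<forall>x\<in>Coh M g n k. integ M g n x = 0)) \<and>
        Vector_Spaces.linear (spin_scl M) (scl M) (spin_push M g n) \<and>
        (\<forall>k. spin_push M g n ` SpinCoh M g n k \<subseteq> Coh M g n k) \<and>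
        chern_E M g n \<in> SpinCoh M g n (2 * g + n - 2) \<and>
        (\<forall>i<n. psi M g n i \<in> Coh M g n 1) \<and>
        kappa1 M g n \<in> Coh M g n 1 \<and>
        (\<forall>\<sigma> m e. bij_betw \<sigma> {..<n} {..<n} \<longrightarrow>
           integ M g n (Theta M g n * kappa1 M g n ^ m * (\<Prod>i<n. psi M g n (\<sigma> i) ^ e i)) =
           integ M g n (Theta M g n * kappa1 M g n ^ m * (\<Prod>i<n. psi M g n i ^ e i))))"


section \<open>Intersection numbers and super volumes\<close>

text \<open>\<open>bracket M g [d\<^sub>1, \<dots>, d\<^sub>n]\<close> is \<open>\<langle>\<tau>\<^bsub>d\<^sub>1\<^esub>, \<dots>, \<tau>\<^bsub>d\<^sub>n\<^esub>\<rangle>\<^sup>\<Theta>\<^sub>g\<close>.\<close>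
definition bracket :: "('h::comm_ring_1, 's::ab_group_add) moduli_data \<Rightarrow> nat \<Rightarrow> nat list \<Rightarrow> complex" where
  "bracket M g ds =
     (let n = length ds in
      if g \<ge> 1 \<and> stable g n
      then integ M g n (Theta M g n * (\<Prod>i<n. psi M g n i ^ (ds ! i)))
      else 0)"

text \<open>
  The exponential of a class of positive degree; the series stops at \<open>dim = 3g - 3 + n\<close>, because
  cohomology vanishes beyond that degree.
\<close>
definition exp_class :: "('h::comm_ring_1, 's::ab_group_add) moduli_data \<Rightarrow> nat \<Rightarrow> nat \<Rightarrow> 'h \<Rightarrow> 'h" where
  "exp_class M g n x = (\<Sum>m\<le>3 * g + n - 3. scl M (1 / fact m) (x ^ m))"

definition super_volume :: "('h::comm_ring_1, 's::ab_group_add) moduli_data \<Rightarrow> nat \<Rightarrow> complex list \<Rightarrow> complex" where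
  "super_volume M g bs =
     (let n = length bs in
      if g \<ge> 1 \<and> stable g n
      then integ M g n (Theta M g n *
             exp_class M g n (scl M (2 * of_real pi ^ 2) (kappa1 M g n) +
               (\<Sum>i<n. scl M ((bs ! i) ^ 2 / 2) (psi M g n i))))
      else 0)"


section \<open>The recursion\<close>

text \<open>
  Ordered set partitions of the labelled entries of a list \<open>bs\<close> are given by the index set \<open>I\<close> of
  the first block; \<open>nths bs I\<close> and \<open>nths bs (- I)\<close> are then the two blocks, and
  \<open>nths bs (- {j})\<close> is \<open>bs\<close> with the entry at \<open>j\<close> removed.
\<close>
definition recursion_lhs :: "('h::comm_ring_1, 's::ab_group_add) moduli_data \<Rightarrow> nat \<Rightarrow> complex \<Rightarrow> complex list \<Rightarrow> complex" where
  "recursion_lhs M g b bs =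
     - (1 / 2) * ((b + 2 * of_real pi * \<i>) * super_volume M g ((b + 2 * of_real pi * \<i>) # bs)
                + (b - 2 * of_real pi * \<i>) * super_volume M g ((b - 2 * of_real pi * \<i>) # bs))"

definition recursion_rhs :: "('h::comm_ring_1, 's::ab_group_add) moduli_data \<Rightarrow> nat \<Rightarrow> complex \<Rightarrow> complex list \<Rightarrow> complex" where
  "recursion_rhs M g b bs =
     1 / 2 * contour_integral (linepath 0 b)
               (\<lambda>t. t * (b - t) * super_volume M (g - 1) (t # (b - t) # bs))
   + 1 / 2 * (\<Sum>(g1, g2)\<in>{(g1, g2). g1 + g2 = g}. \<Sum>I\<in>Pow {..<length bs}.
               contour_integral (linepath 0 b)
                 (\<lambda>t. t * (b - t) * super_volume M g1 (t # nths bs I)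
                                  * super_volume M g2 ((b - t) # nths bs (- I))))
   + 1 / 2 * (\<Sum>j<length bs.
                 (b + bs ! j) * super_volume M g ((b + bs ! j) # nths bs (- {j}))
               + (b - bs ! j) * super_volume M g ((b - bs ! j) # nths bs (- {j})))"

definition super_recursion :: "('h::comm_ring_1, 's::ab_group_add) moduli_data \<Rightarrow> nat \<Rightarrow> nat \<Rightarrow> bool" where
  "super_recursion M g n \<longleftrightarrow>
     (\<forall>b bs. length bs = n - 1 \<longrightarrow> recursion_lhs M g b bs = recursion_rhs M g b bs)"


section \<open>The identity between intersection numbers\<close>

text \<open>
  Double factorial. With truncated subtraction, \<open>dfact (2 * k - 1)\<close> is 1 at \<open>k = 0\<close>, in agreement
  with the convention \<open>(-1)!! = 1\<close>.
\<close>
fun dfact :: "nat \<Rightarrow> nat" where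
  "dfact 0 = 1"
| "dfact (Suc 0) = 1"
| "dfact (Suc (Suc n)) = Suc (Suc n) * dfact n"

definition identity_lhs :: "('h::comm_ring_1, 's::ab_group_add) moduli_data \<Rightarrow> nat \<Rightarrow> nat \<Rightarrow> nat list \<Rightarrow> complex" where
  "identity_lhs M g d ds = - of_nat (dfact (2 * d + 1)) * bracket M g (d # ds)"

text \<open>
  In the second sum \<open>\<mu>\<close> and \<open>\<nu>\<close> are determined by the other indices; a splitting for which they
  would be negative does not contribute.
\<close>
definition identity_rhs :: "('h::comm_ring_1, 's::ab_group_add) moduli_data \<Rightarrow> nat \<Rightarrow> nat \<Rightarrow> nat list \<Rightarrow> complex" where
  "identity_rhs M g d ds =
     1 / 2 * (\<Sum>(\<mu>, \<nu>)\<in>{(\<mu>, \<nu>). \<mu> + \<nu> + 1 = d}.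
                of_nat (dfact (2 * \<mu> + 1) * dfact (2 * \<nu> + 1)) * bracket M (g - 1) (\<mu> # \<nu> # ds))
   + 1 / 2 * (\<Sum>(g1, g2, I, \<mu>, \<nu>)\<in>{(g1, g2, I, \<mu>, \<nu>). g1 + g2 = g \<and> I \<subseteq> {..<length ds} \<and>
                  \<mu> + sum_list (nths ds I) + 1 = g1 \<and> \<nu> + sum_list (nths ds (- I)) + 1 = g2}.
                of_nat (dfact (2 * \<mu> + 1) * dfact (2 * \<nu> + 1))
                  * bracket M g1 (\<mu> # nths ds I) * bracket M g2 (\<nu> # nths ds (- I)))
   + (\<Sum>j<length ds.
        of_nat (dfact (2 * d + 2 * (ds ! j) + 1)) / of_nat (dfact (2 * (ds ! j) - 1))
          * bracket M g ((d + ds ! j) # nths ds (- {j})))"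

lemma finite_second_sum:
  "finite {(g1, g2, I, \<mu>, \<nu>). g1 + g2 = (g::nat) \<and> I \<subseteq> {..<length ds} \<and>
     \<mu> + sum_list (nths ds I) + 1 = g1 \<and> \<nu> + sum_list (nths ds (- I)) + 1 = g2}"
  by (rule finite_subset[of _ "{..g} \<times> {..g} \<times> Pow {..<length ds} \<times> {..g} \<times> {..g}"]) auto


section \<open>Coefficients of polynomial functions\<close>

text \<open>
  \<open>top_coeff n D f e c\<close>: on \<open>\<complex>\<^sup>n\<close> (lists of length \<open>n\<close>), \<open>f\<close> is a polynomial function of total degree
  at most \<open>D\<close>, and \<open>c\<close> is the coefficient in \<open>f\<close> of the monomial with exponent vector \<open>e\<close>, which has
  total degree \<open>D\<close>. The family \<open>a\<close> of all coefficients is indexed by exponent vectors and is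
  uniquely determined by \<open>f\<close>.
\<close>
definition top_coeff :: "nat \<Rightarrow> nat \<Rightarrow> (complex list \<Rightarrow> complex) \<Rightarrow> nat list \<Rightarrow> complex \<Rightarrow> bool" where
  "top_coeff n D f e c \<longleftrightarrow> length e = n \<and> sum_list e = D \<and>
     (\<exists>a. a e = c \<and>
        (\<forall>xs. length xs = n \<longrightarrow>
           f xs = (\<Sum>k | length k = n \<and> sum_list k \<le> D. a k * (\<Prod>i<n. (xs ! i) ^ (k ! i)))))"

lemma finite_exponents: "finite {k::nat list. length k = n \<and> sum_list k \<le> D}"
proof (rule finite_subset)
  show "{k::nat list. length k = n \<and> sum_list k \<le> D} \<subseteq> {k. set k \<subseteq> {..D} \<and> length k = n}"
    by (auto dest: member_le_sum_list)
  show "finite {k. set k \<subseteq> {..D} \<and> length k = n}"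
    by (rule finite_lists_length_eq) simp
qed

end

theory Submission
  imports Defs
begin

text \<open>
  The class \<open>\<Theta>\<close> has degree \<open>2g - 2 + n\<close>, so only the power \<open>g - 1\<close> in the exponential of the super
  volume can be integrated. Expanded in divided powers, its part without \<open>\<kappa>\<^sub>1\<close> gives the monomials
  \<open>\<Prod> b\<^sub>i^(2d\<^sub>i) / (2d\<^sub>i)!!\<close> with the intersection numbers as coefficients. On monomials each term of
  the recursion is explicit: the shifts by \<open>\<plusminus> 2\<pi>i\<close> do not affect the top degree, the integrals are
  beta integrals with value \<open>p! q! / (p + q + 1)! b^(p + q + 1)\<close>, and the shifts by \<open>\<plusminus> b\<^sub>j\<close> contribute
  binomial coefficients. The factorials combine through \<open>(2k + 1)! = (2k + 1)!! (2k)!!\<close>. The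
  identity follows because a polynomial function determines its coefficients.
\<close>

section \<open>Polynomial functions on lists\<close>

definition exps :: "nat \<Rightarrow> nat \<Rightarrow> nat list set" where
  "exps n D = {k. length k = n \<and> sum_list k \<le> D}"

definition monomial :: "complex list \<Rightarrow> nat list \<Rightarrow> complex" where
  "monomial xs k = (\<Prod>i<length xs. xs ! i ^ k ! i)"

lemma finite_exps [simp]: "finite (exps n D)"
  unfolding exps_def by (rule finite_exponents)

lemma monomial_Nil [simp]: "monomial [] k = 1"
  by (simp add: monomial_def)

lemma monomial_Cons [simp]: "monomial (x # xs) (a # k) = x ^ a * monomial xs k"
  by (simp add: monomial_def prod.lessThan_Suc_shift del: prod.lessThan_Suc)

text \<open>Splitting off the first exponent leaves the degree bound \<open>D - x\<close> for the
  others. Inductions on the number of variables use \<open>exps\<close> in this form.\<close>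

lemma sum_exps_Suc:
  "sum f (exps (Suc n) D) = (\<Sum>x\<le>D. \<Sum>k\<in>exps n (D - x). f (x # k))"
proof -
  have "exps (Suc n) D = (\<lambda>p. fst p # snd p) ` (SIGMA x:{..D}. exps n (D - x))"
    by (fastforce simp: exps_def length_Suc_conv image_iff)
  moreover have "inj_on (\<lambda>p. fst p # snd p) (SIGMA x:{..D}. exps n (D - x))"
    by (auto simp: inj_on_def)
  ultimately show ?thesis
    by (simp add: sum.reindex sum.Sigma case_prod_beta comp_def)
qed

text \<open>Induction on the number of variables. With the other variables fixed, the sum is a
  polynomial in the first variable that vanishes identically, so each of its coefficients vanishes;
  these are polynomial functions in one variable fewer.\<close>

lemma coeffs_eq_0:
  assumes "\<And>xs. length xs = n \<Longrightarrow> (\<Sum>k\<in>exps n D. a k * monomial xs k) = 0"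
    and "k \<in> exps n D"
  shows "a k = 0"
  using assms
proof (induction n arbitrary: a D k)
  case 0
  have "exps 0 D = {[]}" by (auto simp: exps_def)
  with "0.prems"(1)[of "[]"] "0.prems"(2) show ?case by simp
next
  case (Suc n)
  from Suc.prems(2) obtain x k' where k: "k = x # k'" "x \<le> D" "k' \<in> exps n (D - x)"
    by (auto simp: exps_def length_Suc_conv)
  have "(\<Sum>k\<in>exps n (D - x). a (x # k) * monomial xs k) = 0" if "length xs = n" for xs
  proof -
    have "(\<Sum>y\<le>D. (\<Sum>k\<in>exps n (D - y). a (y # k) * monomial xs k) * t ^ y) = 0" for t
      using Suc.prems(1)[of "t # xs"] that
      by (simp add: sum_exps_Suc sum_distrib_left sum_distrib_right mult_ac)
    with polyfun_eq_0[of "\<lambda>y. \<Sum>k\<in>exps n (D - y). a (y # k) * monomial xs k" D] k(2)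
    show ?thesis by simp
  qed
  from Suc.IH[OF this k(3)] k(1) show ?case by simp
qed

lemma top_coeff_iff:
  "top_coeff n D f e c \<longleftrightarrow> length e = n \<and> sum_list e = D \<and>
     (\<exists>a. a e = c \<and> (\<forall>xs. length xs = n \<longrightarrow> f xs = (\<Sum>k\<in>exps n D. a k * monomial xs k)))"
  unfolding top_coeff_def exps_def monomial_def by (auto cong: conj_cong)

lemma top_coeff_unique:
  assumes "top_coeff n D f e c" "top_coeff n D f' e c'"
    and "\<And>xs. length xs = n \<Longrightarrow> f xs = f' xs"
  shows "c = c'"
proof -
  obtain a a' where a: "a e = c" "a' e = c'"
    "\<And>xs. length xs = n \<Longrightarrow> f xs = (\<Sum>k\<in>exps n D. a k * monomial xs k)"
    "\<And>xs. length xs = n \<Longrightarrow> f' xs = (\<Sum>k\<in>exps n D. a' k * monomial xs k)"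
    and e: "e \<in> exps n D"
    using assms(1,2) by (auto simp: top_coeff_iff exps_def)
  have "a e - a' e = 0"
    by (rule coeffs_eq_0[where a = "\<lambda>k. a k - a' k", OF _ e])
       (simp add: left_diff_distrib sum_subtractf flip: a(3,4) assms(3))
  with a(1,2) show ?thesis by simp
qed

lemma top_coeff_cong:
  assumes "top_coeff n D f e c" "\<And>xs. length xs = n \<Longrightarrow> f' xs = f xs" "c' = c"
  shows "top_coeff n D f' e c'"
  using assms unfolding top_coeff_iff by auto

lemma top_coeff_add:
  assumes "top_coeff n D f e c" "top_coeff n D f' e c'"
  shows "top_coeff n D (\<lambda>xs. f xs + f' xs) e (c + c')"
proof -
  obtain a a' where "a e = c" "a' e = c'"
    "\<And>xs. length xs = n \<Longrightarrow> f xs = (\<Sum>k\<in>exps n D. a k * monomial xs k)"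
    "\<And>xs. length xs = n \<Longrightarrow> f' xs = (\<Sum>k\<in>exps n D. a' k * monomial xs k)"
    using assms by (auto simp: top_coeff_iff)
  with assms show ?thesis unfolding top_coeff_iff
    by (auto intro!: exI[of _ "\<lambda>k. a k + a' k"] simp: distrib_right sum.distrib)
qed

lemma top_coeff_cmult:
  assumes "top_coeff n D f e c"
  shows "top_coeff n D (\<lambda>xs. r * f xs) e (r * c)"
proof -
  obtain a where "a e = c"
    "\<And>xs. length xs = n \<Longrightarrow> f xs = (\<Sum>k\<in>exps n D. a k * monomial xs k)"
    using assms by (auto simp: top_coeff_iff)
  with assms show ?thesis unfolding top_coeff_iff
    by (auto intro!: exI[of _ "\<lambda>k. r * a k"] simp: sum_distrib_left mult_ac)
qed

lemma top_coeff_0: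
  assumes "length e = n" "sum_list e = D"
  shows "top_coeff n D (\<lambda>xs. 0) e 0"
  using assms unfolding top_coeff_iff by (auto intro!: exI[of _ "\<lambda>k. 0"])

lemma top_coeff_sum:
  assumes "length e = n" "sum_list e = D"
    and "\<And>s. s \<in> S \<Longrightarrow> top_coeff n D (f s) e (c s)"
  shows "top_coeff n D (\<lambda>xs. \<Sum>s\<in>S. f s xs) e (\<Sum>s\<in>S. c s)"
  using assms
proof (induction S rule: infinite_finite_induct)
  case (insert s S)
  then show ?case by (simp add: top_coeff_add)
qed (simp_all add: top_coeff_0)

text \<open>Admitting degrees below \<open>D\<close> handles the lower-order terms of the recursion
  uniformly: their exponent vectors differ from \<open>e\<close>, so they contribute 0.\<close>

lemma top_coeff_monomial:
  assumes "length e = n" "sum_list e = D" "length k = n" "sum_list k \<le> D"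
  shows "top_coeff n D (\<lambda>xs. C * monomial xs k) e (if k = e then C else 0)"
proof -
  have "k \<in> exps n D" using assms by (simp add: exps_def)
  then have "C * monomial xs k = (\<Sum>l\<in>exps n D. (if k = l then C else 0) * monomial xs l)" for xs
    by (simp add: if_distrib[of "\<lambda>z. z * _"] cong: if_cong)
  with assms show ?thesis unfolding top_coeff_iff
    by (auto intro!: exI[of _ "\<lambda>l. if k = l then C else 0"])
qed


section \<open>Splitting a list along an index set\<close>

lemma nths_Compl_Cons:
  "nths (x # xs) (- I) = (if 0 \<in> I then [] else [x]) @ nths xs (- {j. Suc j \<in> I})"
  by (simp add: nths_Cons Collect_neg_eq)

lemma nths_UNIV [simp]: "nths xs UNIV = xs"
  by (simp add: nths_all)

lemma length_nths_cong: "length xs = length ys \<Longrightarrow> length (nths xs I) = length (nths ys I)"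
  by (simp add: length_nths)

lemma nths_eqI:
  assumes "length xs = length ys" "nths xs I = nths ys I" "nths xs (- I) = nths ys (- I)"
  shows "xs = ys"
  using assms
proof (induction xs ys arbitrary: I rule: list_induct2)
  case (Cons x xs y ys)
  then show ?case
    by (cases "0 \<in> I") (auto simp: nths_Compl_Cons nths_Cons[of _ _ I])
qed simp

text \<open>Inverse of splitting: \<open>I\<close> decides which block supplies the next entry. The
  list \<open>xs\<close> serves only to prescribe the lengths.\<close>

lemma nths_merge:
  assumes "length u = length (nths xs I)" "length v = length (nths xs (- I))"
  shows "\<exists>k. length k = length xs \<and> nths k I = u \<and> nths k (- I) = v"
  using assms
proof (induction xs arbitrary: I u v)
  case Nil
  then show ?case by simp
next
  case (Cons x xs)
  let ?J = "{j. Suc j \<in> I}"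
  show ?case
  proof (cases "0 \<in> I")
    case True
    then obtain y u' where "u = y # u'" "length u' = length (nths xs ?J)"
      using Cons.prems(1) by (auto simp: nths_Cons length_Suc_conv)
    moreover obtain k where "length k = length xs" "nths k ?J = u'" "nths k (- ?J) = v"
      using Cons.IH[of u' ?J v] calculation(2) Cons.prems(2) True
      by (auto simp: nths_Compl_Cons)
    ultimately show ?thesis
      using True by (intro exI[of _ "y # k"]) (simp add: nths_Compl_Cons nths_Cons[of _ _ I])
  next
    case False
    then obtain y v' where "v = y # v'" "length v' = length (nths xs (- ?J))"
      using Cons.prems(2) by (auto simp: nths_Compl_Cons length_Suc_conv)
    moreover obtain k where "length k = length xs" "nths k ?J = u" "nths k (- ?J) = v'"
      using Cons.IH[of u ?J v'] calculation(2) Cons.prems(1) False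
      by (auto simp: nths_Cons)
    ultimately show ?thesis
      using False by (intro exI[of _ "y # k"]) (simp add: nths_Compl_Cons nths_Cons[of _ _ I])
  qed
qed

lemma sum_list_nths_Compl:
  "sum_list (nths xs I) + sum_list (nths xs (- I)) = (sum_list xs :: 'a :: comm_monoid_add)"
proof (induction xs arbitrary: I)
  case (Cons x xs)
  show ?case using Cons[of "{j. Suc j \<in> I}"]
    by (auto simp: nths_Compl_Cons nths_Cons[of _ _ I] add_ac)
qed simp

lemma prod_list_nths_Compl:
  "prod_list (nths xs I) * prod_list (nths xs (- I)) = (prod_list xs :: 'a :: comm_monoid_mult)"
proof (induction xs arbitrary: I)
  case (Cons x xs)
  show ?case using Cons[of "{j. Suc j \<in> I}"]
    by (auto simp: nths_Compl_Cons nths_Cons[of _ _ I] mult_ac)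
qed simp

lemma monomial_nths_Compl:
  assumes "length xs = length k"
  shows "monomial (nths xs I) (nths k I) * monomial (nths xs (- I)) (nths k (- I)) = monomial xs k"
  using assms
proof (induction xs k arbitrary: I rule: list_induct2)
  case (Cons x xs y ys)
  show ?case using Cons.IH[of "{j. Suc j \<in> I}"]
    by (auto simp: nths_Compl_Cons nths_Cons[of _ _ I] mult_ac)
qed simp

lemma nths_singleton: "j < length xs \<Longrightarrow> nths xs {j} = [xs ! j]"
proof (induction xs arbitrary: j)
  case (Cons x xs)
  show ?case
  proof (cases j)
    case 0
    then have "{i. Suc i \<in> {j}} = {}" by auto
    with 0 show ?thesis by (simp add: nths_Cons)
  next
    case (Suc i)
    then have "{l. Suc l \<in> {j}} = {i}" by auto
    with Suc Cons show ?thesis by (simp add: nths_Cons)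
  qed
qed simp

text \<open>The common shape of all terms of the recursion: a power of the first variable times
  monomials in two complementary blocks of the others. Merging \<open>u\<close> and \<open>v\<close>
  gives a single monomial. The alternative \<open>C = 0\<close> covers genus 0, where truncated
  subtraction spoils the degree bound.\<close>

lemma top_coeff_split_monomial:
  assumes "D = q + sum_list e"
    and "length u = length (nths e I)" "length v = length (nths e (- I))"
    and "C = 0 \<or> p + sum_list u + sum_list v \<le> D"
  shows "top_coeff (Suc (length e)) D
           (\<lambda>xs. C * (hd xs ^ p * monomial (nths (tl xs) I) u * monomial (nths (tl xs) (- I)) v))
           (q # e) (if p = q \<and> u = nths e I \<and> v = nths e (- I) then C else 0)"
proof (cases "C = 0")
  case True
  then show ?thesis
    using assms(1) top_coeff_0[of "q # e" "Suc (length e)" D] by simp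
next
  case False
  obtain k where k: "length k = length e" "nths k I = u" "nths k (- I) = v"
    using nths_merge[OF assms(2,3)] by blast
  have "sum_list k = sum_list u + sum_list v"
    using sum_list_nths_Compl[of k I] k by simp
  then have "top_coeff (Suc (length e)) D (\<lambda>xs. C * monomial xs (p # k)) (q # e)
          (if p # k = q # e then C else 0)"
    using assms k False by (intro top_coeff_monomial) auto
  then show ?thesis
  proof (rule top_coeff_cong)
    fix xs :: "complex list"
    assume "length xs = Suc (length e)"
    then obtain x ys where "xs = x # ys" "length ys = length k"
      using k by (auto simp: length_Suc_conv)
    then show "C * (hd xs ^ p * monomial (nths (tl xs) I) u * monomial (nths (tl xs) (- I)) v)
             = C * monomial xs (p # k)"
      using monomial_nths_Compl[of ys k I] k by (simp add: mult.assoc)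
  next
    show "(if p = q \<and> u = nths e I \<and> v = nths e (- I) then C else 0)
        = (if p # k = q # e then C else 0)"
      using nths_eqI[of k e I] k by auto
  qed
qed


section \<open>The beta integral on a segment\<close>

text \<open>Integration by parts, by induction on \<open>q\<close>: the function \<open>?F\<close>
  vanishes at both ends of the segment, which trades a factor \<open>b - t\<close> for a factor
  \<open>t\<close>.\<close>

lemma has_contour_integral_beta:
  "((\<lambda>t. t ^ p * (b - t) ^ q) has_contour_integral
     fact p * fact q / fact (p + q + 1) * b ^ (p + q + 1)) (linepath 0 b)"
proof (induction q arbitrary: p)
  case 0
  have "((\<lambda>t. t ^ Suc p / of_nat (Suc p)) has_field_derivative t ^ p) (at t within UNIV)" for t :: complex
    by (rule derivative_eq_intros refl | simp add: field_simps del: of_nat_Suc)+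
  then have "((\<lambda>t. t ^ p) has_contour_integral
      (b ^ Suc p / of_nat (Suc p) - 0 ^ Suc p / of_nat (Suc p))) (linepath 0 b)"
    using contour_integral_primitive[of UNIV "\<lambda>t. t ^ Suc p / of_nat (Suc p)" "\<lambda>t. t ^ p" "linepath 0 b"]
    by simp
  moreover have "b ^ Suc p / of_nat (Suc p) - 0 ^ Suc p / of_nat (Suc p)
      = fact p * fact 0 / fact (p + 0 + 1) * b ^ (p + 0 + 1)"
    by (simp del: of_nat_Suc)
  ultimately show ?case by (simp only: power_0 mult_1_right)
next
  case (Suc q)
  let ?F = "\<lambda>t. t ^ Suc p * (b - t) ^ Suc q"
  let ?f = "\<lambda>t. of_nat (Suc p) * (t ^ p * (b - t) ^ Suc q) - of_nat (Suc q) * (t ^ Suc p * (b - t) ^ q)"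
  have "(?F has_field_derivative ?f t) (at t within UNIV)" for t :: complex
    by (rule derivative_eq_intros refl | simp add: algebra_simps del: of_nat_Suc)+
  then have "(?f has_contour_integral (?F b - ?F 0)) (linepath 0 b)"
    using contour_integral_primitive[of UNIV ?F ?f "linepath 0 b"] by simp
  then have "(?f has_contour_integral 0) (linepath 0 b)" by simp
  \<comment> \<open>Adding the induction hypothesis at \<open>Suc p\<close> cancels the second term
    of \<open>?f\<close>; dividing by \<open>Suc p\<close> isolates the wanted integrand.\<close>
  from has_contour_integral_lmul[OF has_contour_integral_add[OF this
        has_contour_integral_lmul[OF Suc.IH[of "Suc p"], of "of_nat (Suc q)"]], of "1 / of_nat (Suc p)"]
  have "((\<lambda>t. 1 / of_nat (Suc p) * (?f t + of_nat (Suc q) * (t ^ Suc p * (b - t) ^ q))) has_contour_integral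
      1 / of_nat (Suc p) * (0 + of_nat (Suc q) * (fact (Suc p) * fact q / fact (Suc p + q + 1) * b ^ (Suc p + q + 1))))
      (linepath 0 b)" .
  moreover have "1 / of_nat (Suc p) * (?f t + of_nat (Suc q) * (t ^ Suc p * (b - t) ^ q)) = t ^ p * (b - t) ^ Suc q" for t
    by (simp del: of_nat_Suc)
  moreover have "1 / of_nat (Suc p) * (0 + of_nat (Suc q) * (fact (Suc p) * fact q / fact (Suc p + q + 1) * b ^ (Suc p + q + 1)))
     = fact p * fact (Suc q) / fact (p + Suc q + 1) * b ^ (p + Suc q + 1)"
    by (simp add: fact_Suc[of p] fact_Suc[of q] field_simps del: of_nat_Suc fact_Suc)
  ultimately show ?case by (simp only:)
qed


section \<open>Expansion of the super volumes\<close>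

context
  fixes scl :: "complex \<Rightarrow> 'h::comm_ring_1 \<Rightarrow> 'h"
  assumes vs: "vector_space scl" and scl_mult: "\<And>c x y. scl c x * y = scl c (x * y)"
begin

interpretation vector_space scl by (rule vs)

lemma mult_scl: "x * scl c y = scl c (x * y)"
  using scl_mult[of c y x] by (simp add: mult.commute)

lemma scl_of_nat: "scl (of_nat m) x = of_nat m * x"
  by (induction m) (simp_all add: scale_left_distrib distrib_right)

lemma scl_power: "scl c x ^ m = scl (c ^ m) (x ^ m)"
  by (induction m) (simp_all add: scl_mult mult_scl mult.commute)

text \<open>Divided powers absorb the binomial coefficient, because (m choose i) / m! = 1 / (i! (m -
  i)!).\<close>

lemma divided_power_add:
  "scl (1 / fact m) ((x + y) ^ m) =
     (\<Sum>i\<le>m. scl (1 / fact i) (x ^ i) * scl (1 / fact (m - i)) (y ^ (m - i)))"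
proof -
  have "scl (1 / fact m) (of_nat (m choose i) * x ^ i * y ^ (m - i)) =
     scl (1 / fact i) (x ^ i) * scl (1 / fact (m - i)) (y ^ (m - i))" if "i \<le> m" for i
    using that by (simp add: mult.assoc scl_mult mult_scl binomial_fact flip: scl_of_nat)
  then show ?thesis
    by (simp add: binomial_ring scale_sum_right)
qed

text \<open>Multinomial expansion, peeling off one summand at a time; \<open>y\<close> takes the
  degree left over by the \<open>p i\<close>. It is applied with the kappa class as \<open>y\<close>
  and the psi classes as \<open>p i\<close>.\<close>

lemma divided_power_sum:
  "scl (1 / fact m) ((y + (\<Sum>i<n. scl (c i) (p i))) ^ m) =
     (\<Sum>k\<in>exps n m. scl ((\<Prod>i<n. c i ^ (k ! i) / fact (k ! i)) / fact (m - sum_list k))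
        (y ^ (m - sum_list k) * (\<Prod>i<n. p i ^ (k ! i))))"
proof (induction n arbitrary: m c p)
  case 0
  have "exps 0 m = {[]}" by (auto simp: exps_def)
  then show ?case by simp
next
  case (Suc n)
  have "scl (1 / fact m) ((y + (\<Sum>i<Suc n. scl (c i) (p i))) ^ m) =
     scl (1 / fact m) ((scl (c 0) (p 0) + (y + (\<Sum>i<n. scl (c (Suc i)) (p (Suc i))))) ^ m)"
    by (simp add: sum.lessThan_Suc_shift add_ac del: sum.lessThan_Suc)
  also have "\<dots> = (\<Sum>x\<le>m. scl (1 / fact x) (scl (c 0) (p 0) ^ x) *
      scl (1 / fact (m - x)) ((y + (\<Sum>i<n. scl (c (Suc i)) (p (Suc i)))) ^ (m - x)))"
    by (rule divided_power_add)
  also have "\<dots> = (\<Sum>x\<le>m. \<Sum>k\<in>exps n (m - x). scl ((\<Prod>i<Suc n. c i ^ ((x # k) ! i) / fact ((x # k) ! i)) / fact (m - sum_list (x # k)))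
        (y ^ (m - sum_list (x # k)) * (\<Prod>i<Suc n. p i ^ ((x # k) ! i))))"
    by (simp add: Suc.IH sum_distrib_left scl_power scl_mult mult_scl prod.lessThan_Suc_shift
      mult_ac del: prod.lessThan_Suc)
  finally show ?case by (simp add: sum_exps_Suc)
qed

end

section \<open>Double factorials\<close>

lemma dfact_even: "dfact (2 * k) = 2 ^ k * fact k"
  by (induction k) (simp_all add: algebra_simps)

lemma dfact_odd: "dfact (2 * k + 1) * dfact (2 * k) = fact (2 * k + 1)"
  by (induction k) (simp_all add: algebra_simps)

text \<open>At \<open>k = 0\<close> truncation turns the first factor into
  \<open>dfact 0 = 1\<close>, the convention (-1)!! = 1, so no case has to be excluded.\<close>

lemma dfact_odd_pred: "dfact (2 * k - 1) * dfact (2 * k) = fact (2 * k)"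
  using dfact_odd[of "k - 1"] by (cases k) (simp_all add: algebra_simps)

lemma dfact_pos [simp]: "dfact k > 0"
  by (induction k rule: dfact.induct) simp_all

lemma dfact_nonzero [simp]: "dfact k \<noteq> 0"
  using dfact_pos[of k] by simp

definition even_dfacts :: "nat list \<Rightarrow> complex" where
  "even_dfacts k = of_nat (\<Prod>j\<leftarrow>k. dfact (2 * j))"

lemma even_dfacts_Nil [simp]: "even_dfacts [] = 1"
  by (simp add: even_dfacts_def)

lemma even_dfacts_Cons [simp]: "even_dfacts (j # k) = of_nat (dfact (2 * j)) * even_dfacts k"
  by (simp add: even_dfacts_def)

lemma even_dfacts_nonzero [simp]: "even_dfacts k \<noteq> 0"
  by (induction k) simp_all

lemma even_dfacts_nths_Compl:
  "even_dfacts (nths k I) * even_dfacts (nths k (- I)) = even_dfacts k"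
  using prod_list_nths_Compl[of "map (\<lambda>j. dfact (2 * j)) k" I]
  by (simp add: even_dfacts_def nths_map flip: of_nat_mult)

section \<open>Coefficients of the super volumes\<close>

text \<open>The exponent \<open>j\<close> of the kappa class is the part of the degree
  \<open>g - 1\<close> not taken by psi classes. The guard repeats that of
  \<open>super_volume\<close>, so that the expansion also holds for unstable pairs and in genus
  0.\<close>

definition vol_coeff :: "('h::comm_ring_1, 's::ab_group_add) moduli_data \<Rightarrow> nat \<Rightarrow> nat list \<Rightarrow> complex" where
  "vol_coeff M g k =
     (let n = length k; j = g - 1 - sum_list k in
      if g \<ge> 1 \<and> stable g n
      then (2 * of_real pi ^ 2) ^ j / fact j / even_dfacts k *
           integ M g n (Theta M g n * (kappa1 M g n ^ j * (\<Prod>i<n. psi M g n i ^ (k ! i))))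
      else 0)"

lemma vol_coeff_0 [simp]: "vol_coeff M 0 k = 0"
  by (simp add: vol_coeff_def)

lemma vol_coeff_top: "sum_list k = g - 1 \<Longrightarrow> vol_coeff M g k = bracket M g k / even_dfacts k"
  by (simp add: vol_coeff_def bracket_def Let_def)

text \<open>The factor 1 / (2^k k!) coming from the exponential is 1 / (2k)!!.\<close>

lemma monomial_double:
  assumes "length k = length bs"
  shows "(\<Prod>i<length bs. ((bs ! i)\<^sup>2 / 2) ^ (k ! i) / fact (k ! i)) =
     monomial bs (map ((*) 2) k) / even_dfacts k"
  using assms
proof (induction k bs rule: list_induct2)
  case (Cons j k b bs)
  then show ?case
    by (simp add: prod.lessThan_Suc_shift dfact_even power_divide power_mult del: prod.lessThan_Suc)
qed simp

lemma super_volume_expand: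
  fixes M :: "('h::comm_ring_1, 's::ab_group_add) moduli_data"
  assumes M: "moduli_cohomology M" and n: "length bs = n"
  shows "super_volume M g bs =
     (\<Sum>k\<in>exps n (g - 1). vol_coeff M g k * monomial bs (map ((*) 2) k))"
proof (cases "g \<ge> 1 \<and> stable g n")
  case False
  then show ?thesis
    using n by (auto simp: super_volume_def vol_coeff_def exps_def Let_def intro!: sum.neutral[symmetric])
next
  case True
  then have st: "stable g n" "g \<ge> 1" by auto
  interpret S: vector_space "scl M" using M by (simp add: moduli_cohomology_def)
  have scl_mult: "scl M c x * y = scl M c (x * y)" for c x y
    using M by (simp add: moduli_cohomology_def)
  note mult_scl = mult_scl[OF S.vector_space_axioms scl_mult]
  have H: "S.subspace (Coh M g n k)" "1 \<in> Coh M g n 0"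
    "x \<in> Coh M g n k \<Longrightarrow> y \<in> Coh M g n l \<Longrightarrow> x * y \<in> Coh M g n (k + l)"
    "Vector_Spaces.linear (scl M) (*) (integ M g n)"
    "k \<noteq> 3 * g + n - 3 \<Longrightarrow> x \<in> Coh M g n k \<Longrightarrow> integ M g n x = 0"
    "spin_push M g n ` SpinCoh M g n k \<subseteq> Coh M g n k"
    "chern_E M g n \<in> SpinCoh M g n (2 * g + n - 2)"
    "i < n \<Longrightarrow> psi M g n i \<in> Coh M g n 1"
    "kappa1 M g n \<in> Coh M g n 1" for k l x y i
    using M st(1) unfolding moduli_cohomology_def by blast+
  interpret I: Vector_Spaces.linear "scl M" "(*)" "integ M g n" by (rule H(4))
  define z where "z = scl M (2 * of_real pi ^ 2) (kappa1 M g n) + (\<Sum>i<n. scl M ((bs ! i)\<^sup>2 / 2) (psi M g n i))"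
  \<comment> \<open>The argument \<open>z\<close> of the exponential is homogeneous of degree 1, so
    its powers have known degree.\<close>
  have "z \<in> Coh M g n 1"
    unfolding z_def by (intro S.subspace_add S.subspace_scale S.subspace_sum H) auto
  then have zm: "z ^ m \<in> Coh M g n m" for m
    by (induction m) (use H(2) H(3)[of z 1] in auto)
  have Th: "Theta M g n \<in> Coh M g n (2 * g + n - 2)"
    unfolding Theta_def using H(6,7) by (intro S.subspace_scale H(1)) blast
  \<comment> \<open>The product has degree 2g - 2 + n + m, which equals the dimension 3g - 3 + n
    only for m = g - 1.\<close>
  have vanish: "integ M g n (Theta M g n * z ^ m) = 0" if "m \<noteq> g - 1" for m
    using that st by (intro H(5)[OF _ H(3)[OF Th zm]]) (auto simp: stable_def)
  have "super_volume M g bs = (\<Sum>m\<le>3 * g + n - 3. integ M g n (Theta M g n * scl M (1 / fact m) (z ^ m)))"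
    using True n by (simp add: super_volume_def exp_class_def z_def Let_def sum_distrib_left I.sum)
  \<comment> \<open>By stability, \<open>g - 1\<close> lies within the range at which
    \<open>exp_class\<close> stops.\<close>
  also have "\<dots> = (\<Sum>m\<in>{g - 1}. integ M g n (Theta M g n * scl M (1 / fact m) (z ^ m)))"
    using st vanish by (intro sum.mono_neutral_right) (auto simp: stable_def mult_scl I.scale)
  also have "\<dots> = integ M g n (Theta M g n * scl M (1 / fact (g - 1)) (z ^ (g - 1)))" by simp
  also have "\<dots> = (\<Sum>k\<in>exps n (g - 1). vol_coeff M g k * monomial bs (map ((*) 2) k))"
    unfolding z_def divided_power_sum[OF S.vector_space_axioms scl_mult] sum_distrib_left I.sum
  proof (rule sum.cong[OF refl])
    fix k assume "k \<in> exps n (g - 1)"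
    then have k: "length k = length bs" using n by (simp add: exps_def)
    show "integ M g n (Theta M g n * scl M
          ((\<Prod>i<n. ((bs ! i)\<^sup>2 / 2) ^ (k ! i) / fact (k ! i)) / fact (g - 1 - sum_list k))
          (scl M (2 * of_real pi ^ 2) (kappa1 M g n) ^ (g - 1 - sum_list k) * (\<Prod>i<n. psi M g n i ^ (k ! i))))
        = vol_coeff M g k * monomial bs (map ((*) 2) k)"
      using monomial_double[OF k] True k n
      by (simp add: vol_coeff_def Let_def mult_scl scl_mult I.scale
          scl_power[OF S.vector_space_axioms scl_mult] mult.commute)
  qed
  finally show ?thesis .
qed


section \<open>Top coefficients of the recursion\<close>

text \<open>Used to extract coefficients: a sum over all exponents, with summands zero unless the
  exponents match, shrinks to the matching indices.\<close>

lemma sum_reindex_support: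
  assumes "finite E" "inj_on \<phi> S" "\<phi> ` S \<subseteq> E"
    and "\<And>k. k \<in> E \<Longrightarrow> h k \<noteq> 0 \<Longrightarrow> k \<in> \<phi> ` S"
    and "\<And>p. p \<in> S \<Longrightarrow> h (\<phi> p) = h' p"
  shows "sum h E = sum h' S"
proof -
  have "sum h E = sum h (\<phi> ` S)"
    using assms by (intro sum.mono_neutral_right) auto
  also have "\<dots> = sum h' S"
    using assms by (simp add: sum.reindex)
  finally show ?thesis .
qed

lemma sum_list_double: "sum_list (map ((*) 2) k) = 2 * sum_list (k :: nat list)"
  by (simp add: sum_list_const_mult)

lemma map_double_eq_iff [simp]: "map ((*) 2) k = map ((*) 2) l \<longleftrightarrow> k = (l :: nat list)"
  by (intro inj_map_eq_map) (simp add: inj_on_def)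

lemma complex_fact_odd: "(fact (2 * k + 1) :: complex) = of_nat (dfact (2 * k + 1)) * of_nat (dfact (2 * k))"
  by (metis dfact_odd of_nat_fact of_nat_mult)

lemma complex_fact_even: "(fact (2 * k) :: complex) = of_nat (dfact (2 * k - 1)) * of_nat (dfact (2 * k))"
  by (metis dfact_odd_pred of_nat_fact of_nat_mult)

text \<open>Each odd factorial splits as (2k+1)!! (2k)!!. The odd parts are the weights of the
  identity; the even parts will cancel denominators of the volume coefficients.\<close>

lemma beta_coeff:
  assumes "\<mu> + \<nu> + 1 = d"
  shows "fact (2 * \<mu> + 1) * fact (2 * \<nu> + 1) / fact (2 * \<mu> + 1 + (2 * \<nu> + 1) + 1) =
     of_nat (dfact (2 * \<mu> + 1) * dfact (2 * \<nu> + 1)) *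
     (of_nat (dfact (2 * \<mu>)) * of_nat (dfact (2 * \<nu>))) / (fact (2 * d + 1) :: complex)"
proof -
  have "2 * \<mu> + 1 + (2 * \<nu> + 1) + 1 = 2 * d + 1" using assms by simp
  then show ?thesis unfolding complex_fact_odd[of \<mu>] complex_fact_odd[of \<nu>]
    by (simp add: mult_ac del: fact_Suc)
qed

text \<open>The nested form follows the sums of the recursion, one integral for each
  \<open>g1\<close>, \<open>g2\<close>, \<open>I\<close>. The innermost set has at most one
  element.\<close>

lemma separating_sum:
  fixes g :: nat and ds :: "nat list"
    and F :: "nat \<Rightarrow> nat \<Rightarrow> nat set \<Rightarrow> nat \<Rightarrow> nat \<Rightarrow> complex"
  shows "(\<Sum>(g1, g2, I, \<mu>, \<nu>)\<in>{(g1, g2, I, \<mu>, \<nu>). g1 + g2 = g \<and> I \<subseteq> {..<length ds} \<and>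
          \<mu> + sum_list (nths ds I) + 1 = g1 \<and> \<nu> + sum_list (nths ds (- I)) + 1 = g2}. F g1 g2 I \<mu> \<nu>) =
     (\<Sum>(g1, g2)\<in>{(g1, g2). g1 + g2 = g}. \<Sum>I\<in>Pow {..<length ds}.
        \<Sum>(\<mu>, \<nu>)\<in>{(\<mu>, \<nu>). \<mu> + sum_list (nths ds I) + 1 = g1 \<and> \<nu> + sum_list (nths ds (- I)) + 1 = g2}.
          F g1 g2 I \<mu> \<nu>)"
proof -
  let ?P = "{(g1, g2). g1 + g2 = g}" and ?I = "Pow {..<length ds}"
  let ?S = "\<lambda>g1 g2 I. {(\<mu>, \<nu>). \<mu> + sum_list (nths ds I) + 1 = g1 \<and> \<nu> + sum_list (nths ds (- I)) + 1 = g2}"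
  have fin: "finite ?P" "finite (?S g1 g2 I)" for g1 g2 I
    by (rule finite_subset[of _ "{..g} \<times> {..g}"] finite_subset[of _ "{..g1} \<times> {..g2}"]; auto)+
  have "(\<Sum>p\<in>?P. \<Sum>I\<in>?I. \<Sum>r\<in>?S (fst p) (snd p) I. F (fst p) (snd p) I (fst r) (snd r)) =
     (\<Sum>(p, I, r)\<in>(SIGMA p:?P. SIGMA I:?I. ?S (fst p) (snd p) I). F (fst p) (snd p) I (fst r) (snd r))"
    using fin by (simp add: sum.Sigma finite_SigmaI)
  also have "\<dots> = (\<Sum>(g1, g2, I, \<mu>, \<nu>)\<in>{(g1, g2, I, \<mu>, \<nu>). g1 + g2 = g \<and> I \<subseteq> {..<length ds} \<and>
          \<mu> + sum_list (nths ds I) + 1 = g1 \<and> \<nu> + sum_list (nths ds (- I)) + 1 = g2}. F g1 g2 I \<mu> \<nu>)"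
    by (rule sum.reindex_bij_witness[where i = "\<lambda>(g1, g2, I, \<mu>, \<nu>). ((g1, g2), I, \<mu>, \<nu>)"
          and j = "\<lambda>((g1, g2), I, \<mu>, \<nu>). (g1, g2, I, \<mu>, \<nu>)"]) auto
  finally show ?thesis by (simp add: case_prod_unfold)
qed

section \<open>Top coefficients of the individual terms\<close>

context
  fixes M :: "('h::comm_ring_1, 's::ab_group_add) moduli_data"
  assumes M: "moduli_cohomology M"
begin

lemma super_volume_Cons:
  "super_volume M g (u # ys) = (\<Sum>k\<in>exps (Suc (length ys)) (g - 1).
     vol_coeff M g k * (u ^ (2 * hd k) * monomial ys (map ((*) 2) (tl k))))"
  unfolding super_volume_expand[OF M refl] list.size add_0_right add_Suc_right
proof (rule sum.cong[OF refl])
  fix k assume "k \<in> exps (Suc (length ys)) (g - 1)"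
  then obtain x l where "k = x # l" by (auto simp: exps_def length_Suc_conv)
  then show "vol_coeff M g k * monomial (u # ys) (map ((*) 2) k) =
     vol_coeff M g k * (u ^ (2 * hd k) * monomial ys (map ((*) 2) (tl k)))" by simp
qed

text \<open>The prefactor makes the even power of \<open>b + c\<close> odd, and the binomial theorem
  applies. Both kinds of shift, by constants and by entries, are instances.\<close>

lemma super_volume_shift:
  "(b + c) * super_volume M g ((b + c) # ys) =
     (\<Sum>(k, m)\<in>(SIGMA k:exps (Suc (length ys)) (g - 1). {..2 * hd k + 1}).
        vol_coeff M g k * of_nat ((2 * hd k + 1) choose m) *
        (b ^ m * c ^ (2 * hd k + 1 - m) * monomial ys (map ((*) 2) (tl k))))"
proof -
  have "(b + c) * super_volume M g ((b + c) # ys) =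
     (\<Sum>k\<in>exps (Suc (length ys)) (g - 1).
        vol_coeff M g k * ((b + c) ^ (2 * hd k + 1) * monomial ys (map ((*) 2) (tl k))))"
    by (simp add: super_volume_Cons sum_distrib_left mult_ac)
  also have "\<dots> = (\<Sum>k\<in>exps (Suc (length ys)) (g - 1). \<Sum>m\<le>2 * hd k + 1.
        vol_coeff M g k * of_nat ((2 * hd k + 1) choose m) *
        (b ^ m * c ^ (2 * hd k + 1 - m) * monomial ys (map ((*) 2) (tl k))))"
    unfolding binomial_ring sum_distrib_left sum_distrib_right by (simp only: mult_ac)
  finally show ?thesis by (subst sum.Sigma[symmetric]) simp_all
qed

context
  fixes g d :: nat and ds :: "nat list"
  assumes g: "g \<ge> 1" and sum_ds: "d + sum_list ds = g - 1"
begin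

abbreviation (input) "top_exps \<equiv> (2 * d + 1) # map ((*) 2) ds"

lemma length_top_exps: "length top_exps = Suc (length ds)" by simp

lemma sum_top_exps: "sum_list top_exps = 2 * g - 1"
  using g sum_ds by (simp add: sum_list_double)

text \<open>Every power of \<open>c\<close> costs a degree in the first variable, so only the term
  without \<open>c\<close> reaches the top, with binomial coefficient 1.\<close>

lemma top_coeff_shift_const:
  "top_coeff (Suc (length ds)) (2 * g - 1)
     (\<lambda>xs. (hd xs + c) * super_volume M g ((hd xs + c) # tl xs)) top_exps
     (bracket M g (d # ds) / even_dfacts (d # ds))"
proof -
  let ?S = "SIGMA k:exps (Suc (length ds)) (g - 1). {..2 * hd k + 1}"
  let ?C = "\<lambda>(k, m). vol_coeff M g k * of_nat ((2 * hd k + 1) choose m) * c ^ (2 * hd k + 1 - m)"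
  \<comment> \<open>With the index set \<open>{}\<close> the first block is empty and all remaining
    variables lie in the second.\<close>
  have "top_coeff (Suc (length ds)) (2 * g - 1)
     (\<lambda>xs. \<Sum>s\<in>?S. ?C s * (hd xs ^ snd s * monomial (nths (tl xs) {}) []
          * monomial (nths (tl xs) (- {})) (map ((*) 2) (tl (fst s))))) top_exps
     (\<Sum>s\<in>?S. if snd s = 2 * d + 1 \<and> [] = nths (map ((*) 2) ds) {} \<and>
          map ((*) 2) (tl (fst s)) = nths (map ((*) 2) ds) (- {}) then ?C s else 0)"
  proof (rule top_coeff_sum[OF length_top_exps sum_top_exps], goal_cases)
    case (1 s)
    obtain k m where s: "s = (k, m)" by force
    obtain x l where k: "k = x # l" "length l = length ds" "x + sum_list l \<le> g - 1" "m \<le> 2 * x + 1"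
      using 1 by (auto simp: exps_def length_Suc_conv s)
    have D: "2 * g - 1 = 2 * d + 1 + sum_list (map ((*) 2) ds)"
      using sum_top_exps by simp
    show ?case
      unfolding s k(1) prod.case fst_conv snd_conv list.sel using k(2-) g
      by (intro top_coeff_split_monomial[OF D, unfolded length_map]) (auto simp: sum_list_double)
  qed
  then show ?thesis
  proof (rule top_coeff_cong)
    fix xs :: "complex list"
    assume "length xs = Suc (length ds)"
    then show "(hd xs + c) * super_volume M g ((hd xs + c) # tl xs) =
      (\<Sum>s\<in>?S. ?C s * (hd xs ^ snd s * monomial (nths (tl xs) {}) []
          * monomial (nths (tl xs) (- {})) (map ((*) 2) (tl (fst s)))))"
      by (simp add: super_volume_shift case_prod_unfold mult_ac)
  next
    \<comment> \<open>From \<open>m = 2 * d + 1\<close> follows \<open>hd k \<ge> d\<close>, while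
      the bound \<open>g - 1\<close> on the sum of \<open>k\<close> gives
      \<open>hd k \<le> d\<close>.\<close>
    have "(\<Sum>s\<in>?S. if snd s = 2 * d + 1 \<and> [] = nths (map ((*) 2) ds) {} \<and>
          map ((*) 2) (tl (fst s)) = nths (map ((*) 2) ds) (- {}) then ?C s else 0)
        = (\<Sum>s\<in>{(d # ds, 2 * d + 1)}. ?C s)"
      using sum_ds by (intro sum_reindex_support[where \<phi> = id] finite_SigmaI finite_exps finite_atMost)
        (auto simp: exps_def length_Suc_conv split: if_splits)
    then show "bracket M g (d # ds) / even_dfacts (d # ds) =
        (\<Sum>s\<in>?S. if snd s = 2 * d + 1 \<and> [] = nths (map ((*) 2) ds) {} \<and>
          map ((*) 2) (tl (fst s)) = nths (map ((*) 2) ds) (- {}) then ?C s else 0)"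
      using sum_ds by (simp add: vol_coeff_top)
  qed
qed

text \<open>Both signs are treated at once: \<open>\<epsilon>\<close> enters the surviving term with
  the even exponent \<open>2 * (ds ! j)\<close> and drops out.\<close>

lemma top_coeff_shift_entry:
  assumes j: "j < length ds" and \<epsilon>: "\<epsilon>\<^sup>2 = 1"
  shows "top_coeff (Suc (length ds)) (2 * g - 1)
     (\<lambda>xs. (hd xs + \<epsilon> * tl xs ! j) * super_volume M g ((hd xs + \<epsilon> * tl xs ! j) # nths (tl xs) (- {j}))) top_exps
     (of_nat (dfact (2 * d + 2 * (ds ! j) + 1)) / of_nat (dfact (2 * (ds ! j) - 1))
        * bracket M g ((d + ds ! j) # nths ds (- {j})) / (fact (2 * d + 1) * even_dfacts ds))"
proof -
  let ?N = "length (nths ds (- {j}))"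
  let ?S = "SIGMA k:exps (Suc ?N) (g - 1). {..2 * hd k + 1}"
  let ?C = "\<lambda>(k, m). vol_coeff M g k * of_nat ((2 * hd k + 1) choose m) * \<epsilon> ^ (2 * hd k + 1 - m)"
  let ?r = "\<lambda>(k, m). [2 * hd k + 1 - m]"
  let ?c = "\<Sum>s\<in>?S. if snd s = 2 * d + 1 \<and> ?r s = nths (map ((*) 2) ds) {j} \<and>
          map ((*) 2) (tl (fst s)) = nths (map ((*) 2) ds) (- {j}) then ?C s else 0"
  have "top_coeff (Suc (length ds)) (2 * g - 1)
     (\<lambda>xs. \<Sum>s\<in>?S. ?C s * (hd xs ^ snd s * monomial (nths (tl xs) {j}) (?r s)
          * monomial (nths (tl xs) (- {j})) (map ((*) 2) (tl (fst s))))) top_exps ?c"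
  proof (rule top_coeff_sum[OF length_top_exps sum_top_exps], goal_cases)
    case (1 s)
    obtain k m where s: "s = (k, m)" by force
    obtain x l where k: "k = x # l" "length l = ?N" "x + sum_list l \<le> g - 1" "m \<le> 2 * x + 1"
      using 1 by (auto simp: exps_def length_Suc_conv s)
    have D: "2 * g - 1 = 2 * d + 1 + sum_list (map ((*) 2) ds)"
      using sum_top_exps by simp
    show ?case
      unfolding s k(1) prod.case fst_conv snd_conv list.sel using k(2-) g j
      by (intro top_coeff_split_monomial[OF D, unfolded length_map])
         (auto simp: sum_list_double nths_singleton nths_map)
  qed
  then show ?thesis
  proof (rule top_coeff_cong)
    fix xs :: "complex list"
    assume xs: "length xs = Suc (length ds)"
    then have "length (nths (tl xs) (- {j})) = ?N"
      by (intro length_nths_cong) simp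
    with xs j show "(hd xs + \<epsilon> * tl xs ! j) * super_volume M g ((hd xs + \<epsilon> * tl xs ! j) # nths (tl xs) (- {j})) =
      (\<Sum>s\<in>?S. ?C s * (hd xs ^ snd s * monomial (nths (tl xs) {j}) (?r s)
          * monomial (nths (tl xs) (- {j})) (map ((*) 2) (tl (fst s)))))"
      by (simp add: super_volume_shift case_prod_unfold mult_ac nths_singleton power_mult_distrib)
  next
    let ?k = "(d + ds ! j) # nths ds (- {j})"
    have sum_k: "sum_list ?k = g - 1"
      using sum_ds sum_list_nths_Compl[of ds "{j}"] j by (simp add: nths_singleton)
    \<comment> \<open>The exponent of the entry at \<open>j\<close> must be
      \<open>2 * (ds ! j)\<close>, which forces \<open>hd k = d + ds ! j\<close>.\<close>
    have "?c = (\<Sum>s\<in>{(?k, 2 * d + 1)}. ?C s)"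
      using sum_k j by (intro sum_reindex_support[where \<phi> = id] finite_SigmaI finite_exps finite_atMost)
        (auto simp: exps_def length_Suc_conv nths_map nths_singleton split: if_splits)
    also have "\<dots> = of_nat ((2 * (d + ds ! j) + 1) choose (2 * d + 1)) * bracket M g ?k / even_dfacts ?k"
      using sum_k \<epsilon> by (simp add: vol_coeff_top power_mult)
    also have "of_nat ((2 * (d + ds ! j) + 1) choose (2 * d + 1)) =
        fact (2 * (d + ds ! j) + 1) / (fact (2 * d + 1) * (fact (2 * (ds ! j)) :: complex))"
      by (subst binomial_fact) (auto simp: algebra_simps)
    also have "\<dots> = of_nat (dfact (2 * (d + ds ! j) + 1)) * of_nat (dfact (2 * (d + ds ! j))) /
        (fact (2 * d + 1) * (of_nat (dfact (2 * (ds ! j) - 1)) * of_nat (dfact (2 * (ds ! j)))))"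
      by (simp only: complex_fact_odd[of "d + ds ! j"] complex_fact_even[of "ds ! j"])
    finally have "?c = of_nat (dfact (2 * (d + ds ! j) + 1)) * of_nat (dfact (2 * (d + ds ! j))) /
        (fact (2 * d + 1) * (of_nat (dfact (2 * (ds ! j) - 1)) * of_nat (dfact (2 * (ds ! j)))))
        * bracket M g ?k / even_dfacts ?k" .
    \<comment> \<open>The even double factorial of \<open>d + ds ! j\<close> cancels against
      \<open>even_dfacts ?k\<close>; that of \<open>ds ! j\<close> completes the denominator to
      \<open>even_dfacts ds\<close>.\<close>
    moreover have "even_dfacts ds = of_nat (dfact (2 * (ds ! j))) * even_dfacts (nths ds (- {j}))"
      using even_dfacts_nths_Compl[of ds "{j}"] j by (simp add: nths_singleton)
    ultimately show "of_nat (dfact (2 * d + 2 * (ds ! j) + 1)) / of_nat (dfact (2 * (ds ! j) - 1))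
        * bracket M g ?k / (fact (2 * d + 1) * even_dfacts ds) = ?c"
      by (simp add: distrib_left del: fact_Suc)
  qed
qed

text \<open>The factor t(b - t) makes both even exponents odd, so every term is a beta integral
  whose value is a power of b.\<close>

lemma top_coeff_integral_nonseparating:
  "top_coeff (Suc (length ds)) (2 * g - 1)
     (\<lambda>xs. contour_integral (linepath 0 (hd xs))
        (\<lambda>t. t * (hd xs - t) * super_volume M (g - 1) (t # (hd xs - t) # tl xs))) top_exps
     ((\<Sum>(\<mu>, \<nu>)\<in>{(\<mu>, \<nu>). \<mu> + \<nu> + 1 = d}.
         of_nat (dfact (2 * \<mu> + 1) * dfact (2 * \<nu> + 1)) * bracket M (g - 1) (\<mu> # \<nu> # ds))
       / (fact (2 * d + 1) * even_dfacts ds))"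
proof -
  let ?E = "exps (Suc (Suc (length ds))) (g - 1 - 1)"
  let ?p = "\<lambda>k. 2 * hd k + 1" and ?q = "\<lambda>k. 2 * hd (tl k) + 1"
  let ?C = "\<lambda>k. vol_coeff M (g - 1) k * (fact (?p k) * fact (?q k) / fact (?p k + ?q k + 1))"
  let ?c = "\<Sum>k\<in>?E. if ?p k + ?q k + 1 = 2 * d + 1 \<and> [] = nths (map ((*) 2) ds) {} \<and>
          map ((*) 2) (tl (tl k)) = nths (map ((*) 2) ds) (- {}) then ?C k else 0"
  have "top_coeff (Suc (length ds)) (2 * g - 1)
     (\<lambda>xs. \<Sum>k\<in>?E. ?C k * (hd xs ^ (?p k + ?q k + 1) * monomial (nths (tl xs) {}) []
          * monomial (nths (tl xs) (- {})) (map ((*) 2) (tl (tl k))))) top_exps ?c"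
  proof (rule top_coeff_sum[OF length_top_exps sum_top_exps], goal_cases)
    case (1 k)
    then obtain x y l where k: "k = x # y # l" "length l = length ds" "x + (y + sum_list l) \<le> g - 1 - 1"
      by (auto simp: exps_def length_Suc_conv)
    have D: "2 * g - 1 = 2 * d + 1 + sum_list (map ((*) 2) ds)"
      using sum_top_exps by simp
    \<comment> \<open>For \<open>g = 1\<close> the degree bound fails, but the coefficient is 0
      since it belongs to genus 0.\<close>
    show ?case
      unfolding k(1) list.sel using k(2,3) g
      by (intro top_coeff_split_monomial[OF D, unfolded length_map])
         (cases "g - 1 = 0", auto simp: sum_list_double)
  qed
  then show ?thesis
  proof (rule top_coeff_cong)
    fix xs :: "complex list"
    assume xs: "length xs = Suc (length ds)"
    have int: "((\<lambda>t. \<Sum>k\<in>?E. vol_coeff M (g - 1) k * monomial (tl xs) (map ((*) 2) (tl (tl k))) *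
              (t ^ ?p k * (hd xs - t) ^ ?q k)) has_contour_integral
        (\<Sum>k\<in>?E. vol_coeff M (g - 1) k * monomial (tl xs) (map ((*) 2) (tl (tl k))) *
            (fact (?p k) * fact (?q k) / fact (?p k + ?q k + 1) * hd xs ^ (?p k + ?q k + 1))))
        (linepath 0 (hd xs))"
      by (intro has_contour_integral_sum has_contour_integral_lmul has_contour_integral_beta) simp
    have eq: "t * (hd xs - t) * super_volume M (g - 1) (t # (hd xs - t) # tl xs) =
       (\<Sum>k\<in>?E. vol_coeff M (g - 1) k * monomial (tl xs) (map ((*) 2) (tl (tl k))) *
              (t ^ ?p k * (hd xs - t) ^ ?q k))" for t
      unfolding super_volume_Cons sum_distrib_left
    proof (rule sum.cong, goal_cases)
      case (2 k)
      then obtain x y l where "k = x # y # l" by (auto simp: exps_def length_Suc_conv)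
      then show ?case by (simp add: mult_ac)
    qed (use xs in simp)
    have "contour_integral (linepath 0 (hd xs))
        (\<lambda>t. t * (hd xs - t) * super_volume M (g - 1) (t # (hd xs - t) # tl xs)) =
        (\<Sum>k\<in>?E. vol_coeff M (g - 1) k * monomial (tl xs) (map ((*) 2) (tl (tl k))) *
            (fact (?p k) * fact (?q k) / fact (?p k + ?q k + 1) * hd xs ^ (?p k + ?q k + 1)))"
      unfolding eq by (rule contour_integral_unique[OF int])
    also have "\<dots> =
      (\<Sum>k\<in>?E. ?C k * (hd xs ^ (?p k + ?q k + 1) * monomial (nths (tl xs) {}) []
          * monomial (nths (tl xs) (- {})) (map ((*) 2) (tl (tl k)))))"
      by (rule sum.cong) (simp_all add: mult_ac del: fact_Suc)
    finally show "contour_integral (linepath 0 (hd xs))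
        (\<lambda>t. t * (hd xs - t) * super_volume M (g - 1) (t # (hd xs - t) # tl xs)) =
      (\<Sum>k\<in>?E. ?C k * (hd xs ^ (?p k + ?q k + 1) * monomial (nths (tl xs) {}) []
          * monomial (nths (tl xs) (- {})) (map ((*) 2) (tl (tl k)))))" .
  next
    have "?c = (\<Sum>(\<mu>, \<nu>)\<in>{(\<mu>, \<nu>). \<mu> + \<nu> + 1 = d}.
         of_nat (dfact (2 * \<mu> + 1) * dfact (2 * \<nu> + 1)) * bracket M (g - 1) (\<mu> # \<nu> # ds)
          / (fact (2 * d + 1) * even_dfacts ds))"
    proof (rule sum_reindex_support[where \<phi> = "\<lambda>(\<mu>, \<nu>). \<mu> # \<nu> # ds"], goal_cases)
      case 1
      show ?case by simp
    next
      case (4 k)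
      then show ?case by (force simp: exps_def length_Suc_conv split: if_splits)
    next
      case (5 p)
      then obtain \<mu> \<nu> where p: "p = (\<mu>, \<nu>)" "\<mu> + \<nu> + 1 = d" by auto
      \<comment> \<open>The indices have the maximal sum in genus \<open>g - 1\<close>, so no kappa
        class remains and the volume coefficient is a bracket.\<close>
      then have "sum_list (\<mu> # \<nu> # ds) = g - 1 - 1" using sum_ds by simp
      note top = beta_coeff[OF p(2)] vol_coeff_top[OF this]
      show ?case
        unfolding p(1) prod.case list.sel top using p(2) by (simp add: mult_ac del: fact_Suc)
    qed (use sum_ds in \<open>auto simp: inj_on_def exps_def\<close>)
    then show "(\<Sum>(\<mu>, \<nu>)\<in>{(\<mu>, \<nu>). \<mu> + \<nu> + 1 = d}.
         of_nat (dfact (2 * \<mu> + 1) * dfact (2 * \<nu> + 1)) * bracket M (g - 1) (\<mu> # \<nu> # ds))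
       / (fact (2 * d + 1) * even_dfacts ds) = ?c"
      by (simp add: sum_divide_distrib case_prod_unfold)
  qed
qed

text \<open>As in the nonseparating case, now for a product of two volumes whose variables are the
  blocks \<open>I\<close> and \<open>- I\<close>. Top degree of the product forces top degree in
  both factors.\<close>

lemma top_coeff_integral_separating:
  assumes g12: "g1 + g2 = g"
  shows "top_coeff (Suc (length ds)) (2 * g - 1)
     (\<lambda>xs. contour_integral (linepath 0 (hd xs))
        (\<lambda>t. t * (hd xs - t) * super_volume M g1 (t # nths (tl xs) I)
           * super_volume M g2 ((hd xs - t) # nths (tl xs) (- I)))) top_exps
     ((\<Sum>(\<mu>, \<nu>)\<in>{(\<mu>, \<nu>). \<mu> + sum_list (nths ds I) + 1 = g1 \<and> \<nu> + sum_list (nths ds (- I)) + 1 = g2}.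
         of_nat (dfact (2 * \<mu> + 1) * dfact (2 * \<nu> + 1)) *
         bracket M g1 (\<mu> # nths ds I) * bracket M g2 (\<nu> # nths ds (- I)))
       / (fact (2 * d + 1) * even_dfacts ds))"
proof -
  let ?E = "exps (Suc (length (nths ds I))) (g1 - 1) \<times> exps (Suc (length (nths ds (- I)))) (g2 - 1)"
  let ?p = "\<lambda>s. 2 * hd (fst s) + 1" and ?q = "\<lambda>s. 2 * hd (snd s) + 1"
  let ?v = "\<lambda>s. vol_coeff M g1 (fst s) * vol_coeff M g2 (snd s)"
  let ?C = "\<lambda>s. ?v s * (fact (?p s) * fact (?q s) / fact (?p s + ?q s + 1))"
  let ?m = "\<lambda>xs s. monomial (nths (tl xs) I) (map ((*) 2) (tl (fst s)))
          * monomial (nths (tl xs) (- I)) (map ((*) 2) (tl (snd s)))"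
  let ?S = "{(\<mu>, \<nu>). \<mu> + sum_list (nths ds I) + 1 = g1 \<and> \<nu> + sum_list (nths ds (- I)) + 1 = g2}"
  let ?c = "\<Sum>s\<in>?E. if ?p s + ?q s + 1 = 2 * d + 1 \<and>
          map ((*) 2) (tl (fst s)) = nths (map ((*) 2) ds) I \<and>
          map ((*) 2) (tl (snd s)) = nths (map ((*) 2) ds) (- I) then ?C s else 0"
  have "top_coeff (Suc (length ds)) (2 * g - 1)
     (\<lambda>xs. \<Sum>s\<in>?E. ?C s * (hd xs ^ (?p s + ?q s + 1)
          * monomial (nths (tl xs) I) (map ((*) 2) (tl (fst s)))
          * monomial (nths (tl xs) (- I)) (map ((*) 2) (tl (snd s))))) top_exps ?c"
  proof (rule top_coeff_sum[OF length_top_exps sum_top_exps], goal_cases)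
    case (1 s)
    then obtain x k y l where s: "s = (x # k, y # l)" "length k = length (nths ds I)"
      "length l = length (nths ds (- I))" "x + sum_list k \<le> g1 - 1" "y + sum_list l \<le> g2 - 1"
      by (auto simp: exps_def length_Suc_conv)
    have D: "2 * g - 1 = 2 * d + 1 + sum_list (map ((*) 2) ds)"
      using sum_top_exps by simp
    \<comment> \<open>If both genera are positive, the degree is at most 2(g1 - 1) + 2(g2 - 1) + 3 =
      2g - 1; otherwise a volume coefficient vanishes.\<close>
    have "?C s = 0 \<or> 2 * x + 1 + (2 * y + 1) + 1 + 2 * sum_list k + 2 * sum_list l \<le> 2 * g - 1"
      using s(4,5) g12 by (cases "g1 = 0 \<or> g2 = 0") auto
    then show ?case
      unfolding s(1) list.sel fst_conv snd_conv using s(2,3)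
      by (intro top_coeff_split_monomial[OF D, unfolded length_map])
         (auto simp: sum_list_double nths_map)
  qed
  then show ?thesis
  proof (rule top_coeff_cong)
    fix xs :: "complex list"
    assume xs: "length xs = Suc (length ds)"
    then have len: "length (nths (tl xs) J) = length (nths ds J)" for J
      by (intro length_nths_cong) simp
    have int: "((\<lambda>t. \<Sum>s\<in>?E. ?v s * ?m xs s * (t ^ ?p s * (hd xs - t) ^ ?q s)) has_contour_integral
        (\<Sum>s\<in>?E. ?v s * ?m xs s *
            (fact (?p s) * fact (?q s) / fact (?p s + ?q s + 1) * hd xs ^ (?p s + ?q s + 1))))
        (linepath 0 (hd xs))"
      by (intro has_contour_integral_sum has_contour_integral_lmul has_contour_integral_beta) simp
    have eq: "t * (hd xs - t) * super_volume M g1 (t # nths (tl xs) I)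
           * super_volume M g2 ((hd xs - t) # nths (tl xs) (- I)) =
       (\<Sum>s\<in>?E. ?v s * ?m xs s * (t ^ ?p s * (hd xs - t) ^ ?q s))" for t
      unfolding super_volume_Cons len mult.assoc sum_product
      unfolding sum_distrib_left sum.cartesian_product
      by (simp add: case_prod_unfold mult_ac)
    have "contour_integral (linepath 0 (hd xs))
        (\<lambda>t. t * (hd xs - t) * super_volume M g1 (t # nths (tl xs) I)
           * super_volume M g2 ((hd xs - t) # nths (tl xs) (- I))) =
        (\<Sum>s\<in>?E. ?v s * ?m xs s *
            (fact (?p s) * fact (?q s) / fact (?p s + ?q s + 1) * hd xs ^ (?p s + ?q s + 1)))"
      unfolding eq by (rule contour_integral_unique[OF int])
    also have "\<dots> =
      (\<Sum>s\<in>?E. ?C s * (hd xs ^ (?p s + ?q s + 1)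
          * monomial (nths (tl xs) I) (map ((*) 2) (tl (fst s)))
          * monomial (nths (tl xs) (- I)) (map ((*) 2) (tl (snd s)))))"
      by (rule sum.cong) (simp_all add: mult_ac del: fact_Suc)
    finally show "contour_integral (linepath 0 (hd xs))
        (\<lambda>t. t * (hd xs - t) * super_volume M g1 (t # nths (tl xs) I)
           * super_volume M g2 ((hd xs - t) # nths (tl xs) (- I))) =
      (\<Sum>s\<in>?E. ?C s * (hd xs ^ (?p s + ?q s + 1)
          * monomial (nths (tl xs) I) (map ((*) 2) (tl (fst s)))
          * monomial (nths (tl xs) (- I)) (map ((*) 2) (tl (snd s)))))" .
  next
    have split: "sum_list (nths ds I) + sum_list (nths ds (- I)) = sum_list ds"
      by (rule sum_list_nths_Compl)
    have "?c = (\<Sum>(\<mu>, \<nu>)\<in>?S. of_nat (dfact (2 * \<mu> + 1) * dfact (2 * \<nu> + 1)) *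
          bracket M g1 (\<mu> # nths ds I) * bracket M g2 (\<nu> # nths ds (- I))
          / (fact (2 * d + 1) * even_dfacts ds))"
    proof (rule sum_reindex_support[where \<phi> = "\<lambda>(\<mu>, \<nu>). (\<mu> # nths ds I, \<nu> # nths ds (- I))"], goal_cases)
      case 1
      show ?case by simp
    next
      case (4 s)
      then obtain x k y l where s: "s = (x # k, y # l)"
        "x + sum_list k \<le> g1 - 1" "y + sum_list l \<le> g2 - 1"
        by (auto simp: exps_def length_Suc_conv)
      \<comment> \<open>A nonzero summand has positive genera and matching exponents. The two bounds
        by \<open>g1 - 1\<close> and \<open>g2 - 1\<close> then add up to an equality, so each is
        one.\<close>
      have "g1 \<noteq> 0" "g2 \<noteq> 0" "x + y + 1 = d" "k = nths ds I" "l = nths ds (- I)"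
        using 4(2) by (auto simp: s nths_map split: if_splits intro: gr0I)
      with s g12 split sum_ds show ?case by force
    next
      case (5 p)
      then obtain \<mu> \<nu> where p: "p = (\<mu>, \<nu>)" "\<mu> + sum_list (nths ds I) + 1 = g1"
         "\<nu> + sum_list (nths ds (- I)) + 1 = g2" by auto
      then have sums: "sum_list (\<mu> # nths ds I) = g1 - 1" "sum_list (\<nu> # nths ds (- I)) = g2 - 1"
        "\<mu> + \<nu> + 1 = d"
        using sum_ds split g12 by auto
      note top = beta_coeff[OF sums(3)] vol_coeff_top[OF sums(1)] vol_coeff_top[OF sums(2)]
      show ?case
        unfolding p(1) prod.case fst_conv snd_conv list.sel top using sums(3)
        by (simp add: nths_map mult_ac del: fact_Suc flip: even_dfacts_nths_Compl[of ds I])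
    qed (auto simp: inj_on_def exps_def)
    then show "(\<Sum>(\<mu>, \<nu>)\<in>?S. of_nat (dfact (2 * \<mu> + 1) * dfact (2 * \<nu> + 1)) *
         bracket M g1 (\<mu> # nths ds I) * bracket M g2 (\<nu> # nths ds (- I)))
       / (fact (2 * d + 1) * even_dfacts ds) = ?c"
      by (simp add: sum_divide_distrib case_prod_unfold)
  qed
qed

section \<open>Top coefficients of the two sides\<close>

lemma top_coeff_recursion_lhs:
  "top_coeff (Suc (length ds)) (2 * g - 1) (\<lambda>xs. recursion_lhs M g (hd xs) (tl xs)) top_exps
     (identity_lhs M g d ds / (fact (2 * d + 1) * even_dfacts ds))"
proof (rule top_coeff_cong[OF top_coeff_cmult[OF top_coeff_add[OF
        top_coeff_shift_const[of "2 * of_real pi * \<i>"] top_coeff_shift_const[of "- (2 * of_real pi * \<i>)"]], of "- (1 / 2)"]])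
  show "identity_lhs M g d ds / (fact (2 * d + 1) * even_dfacts ds) =
     - (1 / 2) * (bracket M g (d # ds) / even_dfacts (d # ds) + bracket M g (d # ds) / even_dfacts (d # ds))"
    \<comment> \<open>The two shifts contribute equally, and (2d+1)!! / (2d+1)! = 1 /
      (2d)!!.\<close>
    unfolding identity_lhs_def complex_fact_odd by simp
qed (simp add: recursion_lhs_def)

lemma top_coeff_recursion_rhs:
  "top_coeff (Suc (length ds)) (2 * g - 1) (\<lambda>xs. recursion_rhs M g (hd xs) (tl xs)) top_exps
     (identity_rhs M g d ds / (fact (2 * d + 1) * even_dfacts ds))"
proof -
  let ?K = "fact (2 * d + 1) * even_dfacts ds"
  let ?A = "\<Sum>(\<mu>, \<nu>)\<in>{(\<mu>, \<nu>). \<mu> + \<nu> + 1 = d}.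
         of_nat (dfact (2 * \<mu> + 1) * dfact (2 * \<nu> + 1)) * bracket M (g - 1) (\<mu> # \<nu> # ds)"
  let ?B = "\<lambda>g1 g2 I. \<Sum>(\<mu>, \<nu>)\<in>{(\<mu>, \<nu>). \<mu> + sum_list (nths ds I) + 1 = g1 \<and> \<nu> + sum_list (nths ds (- I)) + 1 = g2}.
         of_nat (dfact (2 * \<mu> + 1) * dfact (2 * \<nu> + 1)) *
         bracket M g1 (\<mu> # nths ds I) * bracket M g2 (\<nu> # nths ds (- I))"
  let ?T = "\<lambda>j. of_nat (dfact (2 * d + 2 * (ds ! j) + 1)) / of_nat (dfact (2 * (ds ! j) - 1))
        * bracket M g ((d + ds ! j) # nths ds (- {j}))"
  have sep: "top_coeff (Suc (length ds)) (2 * g - 1)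
     (\<lambda>xs. \<Sum>p\<in>{(g1, g2). g1 + g2 = g}. \<Sum>I\<in>Pow {..<length ds}.
        contour_integral (linepath 0 (hd xs))
        (\<lambda>t. t * (hd xs - t) * super_volume M (fst p) (t # nths (tl xs) I)
           * super_volume M (snd p) ((hd xs - t) # nths (tl xs) (- I)))) top_exps
     (\<Sum>p\<in>{(g1, g2). g1 + g2 = g}. \<Sum>I\<in>Pow {..<length ds}. ?B (fst p) (snd p) I / ?K)"
    by (intro top_coeff_sum[OF length_top_exps sum_top_exps] top_coeff_integral_separating) auto
  \<comment> \<open>The signs are written as factors \<open>1\<close> and \<open>- 1\<close> to
    match \<open>\<epsilon>\<close>.\<close>
  have shift: "top_coeff (Suc (length ds)) (2 * g - 1)
     (\<lambda>xs. \<Sum>j<length ds.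
          (hd xs + 1 * tl xs ! j) * super_volume M g ((hd xs + 1 * tl xs ! j) # nths (tl xs) (- {j}))
        + (hd xs + - 1 * tl xs ! j) * super_volume M g ((hd xs + - 1 * tl xs ! j) # nths (tl xs) (- {j}))) top_exps
     (\<Sum>j<length ds. ?T j / ?K + ?T j / ?K)"
    by (intro top_coeff_sum[OF length_top_exps sum_top_exps] top_coeff_add top_coeff_shift_entry) auto
  show ?thesis
  proof (rule top_coeff_cong[OF top_coeff_add[OF top_coeff_add[OF
        top_coeff_cmult[OF top_coeff_integral_nonseparating, of "1 / 2"]
        top_coeff_cmult[OF sep, of "1 / 2"]] top_coeff_cmult[OF shift, of "1 / 2"]]])
    let ?BB = "\<Sum>p\<in>{(g1, g2). g1 + g2 = g}. \<Sum>I\<in>Pow {..<length ds}. ?B (fst p) (snd p) I"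
    have split: "identity_rhs M g d ds = 1 / 2 * ?A + 1 / 2 * ?BB + (\<Sum>j<length ds. ?T j)"
      unfolding identity_rhs_def separating_sum by (simp only: case_prod_unfold)
    \<comment> \<open>The two equal contributions of each entry cancel the factor 1/2, which is why
      the last sum of the identity has none.\<close>
    have half: "(1 / 2 * a + 1 / 2 * b + c) / k = 1 / 2 * (a / k) + 1 / 2 * (b / k) + 1 / 2 * (c / k + c / k)"
      for a b c k :: complex
      by (simp add: add_divide_distrib)
    show "identity_rhs M g d ds / ?K = 1 / 2 * (?A / ?K) +
        1 / 2 * (\<Sum>p\<in>{(g1, g2). g1 + g2 = g}. \<Sum>I\<in>Pow {..<length ds}. ?B (fst p) (snd p) I / ?K) +
        1 / 2 * (\<Sum>j<length ds. ?T j / ?K + ?T j / ?K)"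
      by (simp only: split half sum.distrib flip: sum_divide_distrib)
  qed (simp add: recursion_rhs_def case_prod_unfold)
qed

end

end

theorem theorem5p2:
  fixes M :: "('h::comm_ring_1, 's::ab_group_add) moduli_data"
    and g n d :: nat and ds :: "nat list"
  assumes "moduli_cohomology M"
    and "g \<ge> 1" and "n \<ge> 1" and "2 * g - 2 + n \<ge> 2"
    and "length ds = n - 1"
    and "d + sum_list ds = g - 1"
  defines "e \<equiv> (2 * d + 1) # map (\<lambda>k. 2 * k) ds"
    and "K \<equiv> of_nat (fact (2 * d + 1) * (\<Prod>k\<leftarrow>ds. dfact (2 * k))) :: complex"
  shows "top_coeff n (2 * g - 1) (\<lambda>xs. recursion_lhs M g (hd xs) (tl xs)) e
           (identity_lhs M g d ds / K) \<and>
         top_coeff n (2 * g - 1) (\<lambda>xs. recursion_rhs M g (hd xs) (tl xs)) e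
           (identity_rhs M g d ds / K) \<and>
         (super_recursion M g n \<longrightarrow> identity_lhs M g d ds = identity_rhs M g d ds)"
proof -
  have n: "n = Suc (length ds)" using assms(3,5) by simp
  have K: "K = fact (2 * d + 1) * even_dfacts ds"
    unfolding K_def even_dfacts_def of_nat_mult of_nat_fact ..
  have L: "top_coeff n (2 * g - 1) (\<lambda>xs. recursion_lhs M g (hd xs) (tl xs)) e (identity_lhs M g d ds / K)"
    and R: "top_coeff n (2 * g - 1) (\<lambda>xs. recursion_rhs M g (hd xs) (tl xs)) e (identity_rhs M g d ds / K)"
    unfolding n K e_def
    by (rule top_coeff_recursion_lhs[OF assms(1,2,6)] top_coeff_recursion_rhs[OF assms(1,2,6)])+
  have "identity_lhs M g d ds = identity_rhs M g d ds" if "super_recursion M g n"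
  proof -
    \<comment> \<open>The recursion equates the two sides as functions of all variables, so their
      coefficients at \<open>e\<close> agree; the common factor \<open>K\<close> is nonzero and
      cancels.\<close>
    have "identity_lhs M g d ds / K = identity_rhs M g d ds / K"
      using that by (intro top_coeff_unique[OF L R]) (simp add: super_recursion_def)
    moreover have "K \<noteq> 0" by (simp add: K del: fact_Suc)
    ultimately show ?thesis by simp
  qed
  with L R show ?thesis by blast
qed

end
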